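(* Let $\{v^{(1)},\dots,v^{(N)}\}\subseteq\mathbb R^d$ be a tight frame with constant $\sigma=\frac1d\sum_i\|v^{(i)}\|^2$. For $c_1,\dots,c_N>0$, set $K=\operatorname{conv}\{\pm c_iv^{(i)}:i=1,\dots,N\}$. Define $$\kappa=\frac{\sigma\,\min_ic_i^3}{\sum_ic_i}=\frac{\sum_i\|v^{(i)}\|^2}{\sum_ic_i}\cdot\frac{\min_ic_i^3}{d}.$$ Then $$\kappa\,\mathcal W^{\max}(K')\subseteq\mathcal W^{\min}(K).$$
   Context: A finite set $\{v^{(1)},\dots,v^{(N)}\}\subseteq\mathbb R^d$ is a tight frame with constant $\sigma>0$ if $\sum_i|\langle v^{(i)},x\rangle|^2=\sigma\|x\|^2$ for all $x\in\mathbb R^d$ (equivalently $\sum_iv^{(i)}v^{(i)*}=\sigma I$; then necessarily $\sigma=\frac1d\sum_i\|v^{(i)}\|^2$). The scalar polar dual is $K'=\{x\in\mathbb R^d:\sum_jx_jy_j\le1\text{ for all }y\in K\}$. $(M_n)^d_{sa}$ is the set of $d$-tuples of self-adjoint $n\times n$ complex matrices. For a closed convex $E\subseteq\mathbb R^d$: $\mathcal W^{\min}(E)=\bigcup_n\mathcal W^{\min}_n(E)$, where $\mathcal W^{\min}_n(E)$ is the set of $X\in(M_n)^d_{sa}$ for which there are a tuple $N$ of commuting normal operators on a Hilbert space $L$ with joint spectrum $\sigma(N)\subseteq E$ and an isometry $V:\mathbb C^n\to L$ with $X_i=V^*N_iV$ for all $i$; and $\mathcal W^{\max}(E)=\bigcup_n\mathcal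 W^{\max}_n(E)$, where $\mathcal W^{\max}_n(E)$ is the set of $X\in(M_n)^d_{sa}$ such that $\sum_i\alpha_iX_i\le aI_n$ whenever $\alpha\in\mathbb R^d$, $a\in\mathbb R$ satisfy $\sum_i\alpha_ix_i\le a$ for all $x\in E$. $c\,\mathcal S=\{cX:X\in\mathcal S\}$; inclusion means inclusion at every level $n$. *)

theory Defs
  imports "HOL-Analysis.Analysis"
begin

section \<open>Complex Hilbert spaces with explicit carrier\<close>

record 'h hilb =
  hcar :: "'h set"
  hadd :: "'h \<Rightarrow> 'h \<Rightarrow> 'h"
  hzero :: "'h"
  hscale :: "complex \<Rightarrow> 'h \<Rightarrow> 'h"
  hinner :: "'h \<Rightarrow> 'h \<Rightarrow> complex"

definition hnorm :: "'h hilb \<Rightarrow> 'h \<Rightarrow> real" where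
  "hnorm H x = sqrt (Re (hinner H x x))"

definition hdiff :: "'h hilb \<Rightarrow> 'h \<Rightarrow> 'h \<Rightarrow> 'h" where
  "hdiff H x y = hadd H x (hscale H (-1) y)"

text \<open>The inner product is linear in its first argument.\<close>

locale hilbert_space =
  fixes H :: "'h hilb"
  assumes add_closed: "x \<in> hcar H \<Longrightarrow> y \<in> hcar H \<Longrightarrow> hadd H x y \<in> hcar H"
    and zero_closed: "hzero H \<in> hcar H"
    and scale_closed: "x \<in> hcar H \<Longrightarrow> hscale H a x \<in> hcar H"
    and add_assoc: "x \<in> hcar H \<Longrightarrow> y \<in> hcar H \<Longrightarrow> z \<in> hcar H \<Longrightarrow>
          hadd H (hadd H x y) z = hadd H x (hadd H y z)"
    and add_commute: "x \<in> hcar H \<Longrightarrow> y \<in> hcar H \<Longrightarrow> hadd H x y = hadd H y x"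
    and add_zero: "x \<in> hcar H \<Longrightarrow> hadd H x (hzero H) = x"
    and diff_self: "x \<in> hcar H \<Longrightarrow> hdiff H x x = hzero H"
    and scale_one: "x \<in> hcar H \<Longrightarrow> hscale H 1 x = x"
    and scale_scale: "x \<in> hcar H \<Longrightarrow> hscale H a (hscale H b x) = hscale H (a * b) x"
    and scale_add_right: "x \<in> hcar H \<Longrightarrow> y \<in> hcar H \<Longrightarrow>
          hscale H a (hadd H x y) = hadd H (hscale H a x) (hscale H a y)"
    and scale_add_left: "x \<in> hcar H \<Longrightarrow>
          hscale H (a + b) x = hadd H (hscale H a x) (hscale H b x)"
    and inner_commute: "x \<in> hcar H \<Longrightarrow> y \<in> hcar H \<Longrightarrow> hinner H y x = cnj (hinner H x y)"
    and inner_add: "x \<in> hcar H \<Longrightarrow> y \<in> hcar H \<Longrightarrow> z \<in> hcar H \<Longrightarrow>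
          hinner H (hadd H x y) z = hinner H x z + hinner H y z"
    and inner_scale: "x \<in> hcar H \<Longrightarrow> y \<in> hcar H \<Longrightarrow>
          hinner H (hscale H a x) y = a * hinner H x y"
    and inner_pos: "x \<in> hcar H \<Longrightarrow> x \<noteq> hzero H \<Longrightarrow> 0 < Re (hinner H x x)"
    and complete: "range s \<subseteq> hcar H \<Longrightarrow>
          \<forall>e>0. \<exists>M::nat. \<forall>m\<ge>M. \<forall>k\<ge>M. hnorm H (hdiff H (s m) (s k)) < e \<Longrightarrow>
          \<exists>l\<in>hcar H. (\<lambda>k. hnorm H (hdiff H (s k) l)) \<longlonglongrightarrow> 0"

definition Cn :: "(complex ^ 'n) hilb" where
  "Cn = \<lparr>hcar = UNIV, hadd = (+), hzero = 0, hscale = (*s),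
         hinner = (\<lambda>x y. \<Sum>i\<in>UNIV. x $ i * cnj (y $ i))\<rparr>"

lemma hnorm_Cn: "hnorm Cn x = norm x"
  by (simp add: hnorm_def Cn_def norm_vec_def L2_set_def complex_norm_square[symmetric]
      del: of_real_power)

lemma hdiff_Cn: "hdiff Cn x y = x - y"
  by (simp add: hdiff_def Cn_def vec_eq_iff)

lemma hilbert_space_Cn: "hilbert_space (Cn :: (complex ^ 'n) hilb)"
proof
  fix x :: "complex ^ 'n"
  assume "x \<noteq> hzero Cn"
  then have "0 < hnorm Cn x"
    by (simp add: hnorm_Cn) (simp add: Cn_def)
  then show "0 < Re (hinner Cn x x)"
    by (simp add: hnorm_def)
next
  fix s :: "nat \<Rightarrow> complex ^ 'n"
  assume "\<forall>e>0. \<exists>M::nat. \<forall>m\<ge>M. \<forall>k\<ge>M. hnorm Cn (hdiff Cn (s m) (s k)) < e"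
  then have "Cauchy s"
    by (simp add: Cauchy_def hnorm_Cn hdiff_Cn dist_norm)
  then obtain l where "s \<longlonglongrightarrow> l"
    using Cauchy_convergent_iff convergent_def by blast
  then have "(\<lambda>k. hnorm Cn (hdiff Cn (s k) l)) \<longlonglongrightarrow> 0"
    by (simp add: hnorm_Cn hdiff_Cn tendsto_norm_zero_iff LIM_zero_iff)
  then show "\<exists>l\<in>hcar Cn. (\<lambda>k. hnorm Cn (hdiff Cn (s k) l)) \<longlonglongrightarrow> 0"
    by (auto simp: Cn_def)
qed (auto simp: hdiff_def Cn_def vec_eq_iff algebra_simps sum.distrib sum_distrib_left)

section \<open>Bounded operators\<close>

text \<open>Operators are extensional (\<open>undefined\<close> outside the carrier), so that equality of
  operators is equality of functions.\<close>

definition bounded_ops :: "'g hilb \<Rightarrow> 'h hilb \<Rightarrow> ('g \<Rightarrow> 'h) set" where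
  "bounded_ops G H = {T \<in> hcar G \<rightarrow>\<^sub>E hcar H.
     (\<forall>x\<in>hcar G. \<forall>y\<in>hcar G. T (hadd G x y) = hadd H (T x) (T y)) \<and>
     (\<forall>a. \<forall>x\<in>hcar G. T (hscale G a x) = hscale H a (T x)) \<and>
     (\<exists>B. \<forall>x\<in>hcar G. hnorm H (T x) \<le> B * hnorm G x)}"

definition op_id :: "'h hilb \<Rightarrow> 'h \<Rightarrow> 'h" where
  "op_id H = (\<lambda>x\<in>hcar H. x)"

definition op_add :: "'h hilb \<Rightarrow> ('h \<Rightarrow> 'h) \<Rightarrow> ('h \<Rightarrow> 'h) \<Rightarrow> 'h \<Rightarrow> 'h" where
  "op_add H S T = (\<lambda>x\<in>hcar H. hadd H (S x) (T x))"

definition op_scale :: "'h hilb \<Rightarrow> complex \<Rightarrow> ('h \<Rightarrow> 'h) \<Rightarrow> 'h \<Rightarrow> 'h" where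
  "op_scale H a T = (\<lambda>x\<in>hcar H. hscale H a (T x))"

definition op_mult :: "'h hilb \<Rightarrow> ('h \<Rightarrow> 'h) \<Rightarrow> ('h \<Rightarrow> 'h) \<Rightarrow> 'h \<Rightarrow> 'h" where
  "op_mult H S T = compose (hcar H) S T"

definition op_adj :: "'g hilb \<Rightarrow> 'h hilb \<Rightarrow> ('g \<Rightarrow> 'h) \<Rightarrow> 'h \<Rightarrow> 'g" where
  "op_adj G H T = (THE S. S \<in> bounded_ops H G \<and>
     (\<forall>x\<in>hcar G. \<forall>y\<in>hcar H. hinner H (T x) y = hinner G x (S y)))"

definition normal_op :: "'h hilb \<Rightarrow> ('h \<Rightarrow> 'h) \<Rightarrow> bool" where
  "normal_op H T \<longleftrightarrow> T \<in> bounded_ops H H \<and>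
     op_mult H T (op_adj H H T) = op_mult H (op_adj H H T) T"

definition isometry_op :: "'g hilb \<Rightarrow> 'h hilb \<Rightarrow> ('g \<Rightarrow> 'h) \<Rightarrow> bool" where
  "isometry_op G H V \<longleftrightarrow> V \<in> bounded_ops G H \<and> (\<forall>x\<in>hcar G. hnorm H (V x) = hnorm G x)"

section \<open>Joint spectrum\<close>

text \<open>The last clause of the definition is closedness in the operator norm.\<close>

definition unital_cstar_subalgebra :: "'h hilb \<Rightarrow> ('h \<Rightarrow> 'h) set \<Rightarrow> bool" where
  "unital_cstar_subalgebra H A \<longleftrightarrow>
     A \<subseteq> bounded_ops H H \<and> op_id H \<in> A \<and>
     (\<forall>S\<in>A. \<forall>T\<in>A. op_add H S T \<in> A \<and> op_mult H S T \<in> A) \<and>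
     (\<forall>a. \<forall>T\<in>A. op_scale H a T \<in> A) \<and>
     (\<forall>T\<in>A. op_adj H H T \<in> A) \<and>
     (\<forall>T\<in>bounded_ops H H.
        (\<forall>e>0. \<exists>S\<in>A. \<forall>x\<in>hcar H. hnorm H (hdiff H (T x) (S x)) \<le> e * hnorm H x) \<longrightarrow> T \<in> A)"

definition cstar_gen :: "'h hilb \<Rightarrow> ('h \<Rightarrow> 'h) set \<Rightarrow> ('h \<Rightarrow> 'h) set" where
  "cstar_gen H G = \<Inter> {A. unital_cstar_subalgebra H A \<and> G \<subseteq> A}"

definition character_on ::
    "'h hilb \<Rightarrow> ('h \<Rightarrow> 'h) set \<Rightarrow> (('h \<Rightarrow> 'h) \<Rightarrow> complex) \<Rightarrow> bool" where
  "character_on H A \<phi> \<longleftrightarrow>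
     \<phi> (op_id H) = 1 \<and>
     (\<forall>S\<in>A. \<forall>T\<in>A. \<phi> (op_add H S T) = \<phi> S + \<phi> T \<and> \<phi> (op_mult H S T) = \<phi> S * \<phi> T) \<and>
     (\<forall>a. \<forall>T\<in>A. \<phi> (op_scale H a T) = a * \<phi> T)"

text \<open>The joint spectrum of a commuting tuple of normal operators, via the Gelfand spectrum of
  the commutative unital \<open>C\<^sup>*\<close>-algebra that the tuple generates.\<close>

definition joint_spectrum :: "'h hilb \<Rightarrow> ('d::finite \<Rightarrow> 'h \<Rightarrow> 'h) \<Rightarrow> (complex ^ 'd) set" where
  "joint_spectrum H N =
     {(\<chi> i. \<phi> (N i)) |\<phi>. character_on H (cstar_gen H (range N)) \<phi>}"

section \<open>Matrix convex sets\<close>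

definition conj_transpose :: "complex ^ 'n ^ 'm \<Rightarrow> complex ^ 'm ^ 'n" where
  "conj_transpose A = (\<chi> i j. cnj (A $ j $ i))"

definition self_adjoint :: "complex ^ 'n ^ 'n \<Rightarrow> bool" where
  "self_adjoint A \<longleftrightarrow> conj_transpose A = A"

definition psd :: "complex ^ 'n ^ 'n \<Rightarrow> bool" where
  "psd A \<longleftrightarrow> self_adjoint A \<and> (\<forall>z. 0 \<le> Re (hinner Cn (A *v z) z))"

definition loewner_le :: "complex ^ 'n ^ 'n \<Rightarrow> complex ^ 'n ^ 'n \<Rightarrow> bool" where
  "loewner_le A B \<longleftrightarrow> psd (B - A)"

text \<open>\<open>Wmax E\<close> and \<open>Wmin E\<close> at type \<open>((complex ^ 'n ^ 'n) ^ 'd) set\<close> are the levels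
  \<open>n = CARD('n)\<close> of the matrix convex sets; a statement that is polymorphic in \<open>'n\<close> is a
  statement about all levels.\<close>

definition Wmax :: "(real ^ 'd) set \<Rightarrow> ((complex ^ 'n ^ 'n) ^ 'd) set" where
  "Wmax E = {X. (\<forall>i. self_adjoint (X $ i)) \<and>
     (\<forall>(\<alpha> :: real ^ 'd) (a :: real). (\<forall>x\<in>E. (\<Sum>i\<in>UNIV. \<alpha> $ i * x $ i) \<le> a) \<longrightarrow>
        loewner_le (\<Sum>i\<in>UNIV. \<alpha> $ i *\<^sub>R X $ i) (a *\<^sub>R mat 1))}"

definition normal_dilation ::
    "'h hilb \<Rightarrow> (real ^ 'd) set \<Rightarrow> ((complex ^ 'n ^ 'n) ^ 'd) \<Rightarrow> bool" where
  "normal_dilation L E X \<longleftrightarrow>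
     (\<exists>(N :: 'd \<Rightarrow> 'h \<Rightarrow> 'h) (V :: complex ^ 'n \<Rightarrow> 'h).
        (\<forall>i. normal_op L (N i)) \<and>
        (\<forall>i j. op_mult L (N i) (N j) = op_mult L (N j) (N i)) \<and>
        joint_spectrum L N \<subseteq> (\<lambda>x. \<chi> i. complex_of_real (x $ i)) ` E \<and>
        isometry_op Cn L V \<and>
        (\<forall>i z. X $ i *v z = op_adj Cn L V (N i (V z))))"

text \<open>A quantifier over Hilbert spaces has to fix a type for their elements.  Up to unitary
  equivalence the carriers inside \<open>nat \<Rightarrow> complex\<close> give every Hilbert space of cardinality at
  most the continuum (the linear structure and the inner product are arbitrary, not those of
  sequences), in particular every separable one.  Larger spaces contribute nothing new: the
  closed subspace generated by the range of \<open>V\<close> under the \<open>N i\<close> and their adjoints is separable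
  and reducing, and restricting the \<open>N i\<close> to it does not enlarge the joint spectrum.\<close>

definition Wmin :: "(real ^ 'd) set \<Rightarrow> ((complex ^ 'n ^ 'n) ^ 'd) set" where
  "Wmin E = {X. (\<forall>i. self_adjoint (X $ i)) \<and>
     (\<exists>L :: (nat \<Rightarrow> complex) hilb. hilbert_space L \<and> normal_dilation L E X)}"

section \<open>Frames and polar duals\<close>

definition tight_frame :: "nat \<Rightarrow> (nat \<Rightarrow> real ^ 'd) \<Rightarrow> real \<Rightarrow> bool" where
  "tight_frame N v \<sigma> \<longleftrightarrow> 0 < \<sigma> \<and> (\<forall>x. (\<Sum>i=1..N. \<bar>v i \<bullet> x\<bar>\<^sup>2) = \<sigma> * (norm x)\<^sup>2)"

definition polar_dual :: "(real ^ 'd) set \<Rightarrow> (real ^ 'd) set" where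
  "polar_dual K = {x. \<forall>y\<in>K. (\<Sum>j\<in>UNIV. x $ j * y $ j) \<le> 1}"

end

theory Submission
  imports Defs
begin

text \<open>Write \<open>T\<^sub>i = \<langle>v\<^sub>i, X\<rangle>\<close>, \<open>m = min c\<^sub>i\<^sup>3\<close> and \<open>S = \<Sum> c\<^sub>i\<close>. Since \<open>\<plusminus> c\<^sub>i v\<^sub>i \<in> K\<close>, membership of \<open>X\<close> in
  \<open>Wmax (polar_dual K)\<close> gives \<open>- I \<le> c\<^sub>i T\<^sub>i \<le> I\<close>, and the frame identity gives \<open>\<sigma> X = \<Sum> v\<^sub>i T\<^sub>i\<close>.
  As \<open>m / c\<^sub>i\<^sup>2 \<le> c\<^sub>i\<close>, the matrices \<open>(c\<^sub>i I \<plusminus> (m / c\<^sub>i) T\<^sub>i) / (2 S)\<close> are positive; they sum to \<open>I\<close>, and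
  \<open>\<kappa> X\<close> is their combination with the coefficients \<open>\<plusminus> c\<^sub>i v\<^sub>i\<close>. Splitting them into rank-one matrices
  \<open>a\<^sub>m a\<^sub>m\<^sup>*\<close> makes \<open>z \<mapsto> (\<langle>z, a\<^sub>m\<rangle>)\<^sub>m\<close> an isometry that compresses diagonal operators with entries
  \<open>\<plusminus> c\<^sub>i v\<^sub>i\<close> to \<open>\<kappa> X\<close>.\<close>

section \<open>Rank-one decomposition of positive semidefinite matrices\<close>

definition outer :: "complex ^ 'n \<Rightarrow> complex ^ 'n ^ 'n" where
  "outer a = (\<chi> i j. a $ i * cnj (a $ j))"

lemma outer_mult_vec: "outer a *v z = hinner Cn z a *s a"
  by (simp add: outer_def Cn_def vec_eq_iff matrix_vector_mult_def sum_distrib_left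
      sum_distrib_right mult_ac)

lemma hinner_outer: "hinner Cn (outer a *v z) z = of_real ((cmod (hinner Cn z a))\<^sup>2)"
proof -
  have "hinner Cn (outer a *v z) z = hinner Cn z a * hinner Cn a z"
    unfolding outer_mult_vec
    using hilbert_space.inner_scale[OF hilbert_space_Cn] by (simp add: Cn_def)
  also have "hinner Cn a z = cnj (hinner Cn z a)"
    using hilbert_space.inner_commute[OF hilbert_space_Cn, of z a] by (simp add: Cn_def)
  finally show ?thesis
    by (simp only: complex_norm_square)
qed

lemma matrix_vector_mult_axis:
  fixes A :: "complex ^ 'n ^ 'm"
  shows "A *v axis k 1 = column k A"
  by (simp add: vec_eq_iff matrix_vector_mult_def column_def axis_def if_distrib cong: if_cong)

lemma scaleR_matrix_vector_mult:
  fixes A :: "complex ^ 'n ^ 'm"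
  shows "(r *\<^sub>R A) *v z = of_real r *s (A *v z)"
  by (simp add: vec_eq_iff matrix_vector_mult_def scaleR_conv_of_real[where 'a = complex]
      sum_distrib_left mult_ac)

text \<open>The right-hand side is the quadratic form of \<open>P\<close> at \<open>z - t e\<^sub>k\<close>.\<close>

lemma psd_column_perturb:
  assumes "psd P"
  shows "0 \<le> Re (hinner Cn (P *v z) z) - 2 * Re (cnj t * (P *v z) $ k)
      + (cmod t)\<^sup>2 * Re (P $ k $ k)"
proof -
  have sa: "cnj (P $ i $ j) = P $ j $ i" for i j
    using assms by (simp add: psd_def self_adjoint_def conj_transpose_def vec_eq_iff)
  let ?w = "z - t *s axis k 1"
  have Pk: "P *v axis k 1 = column k P"
    by (rule matrix_vector_mult_axis)
  have "P *v (t *s axis k 1) = t *s column k P"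
    unfolding Pk[symmetric] by (simp add: vec_eq_iff matrix_vector_mult_def sum_distrib_left mult_ac)
  then have Pw: "P *v ?w = P *v z - t *s column k P"
    by (simp add: matrix_vector_mult_diff_distrib)
  have e1: "hinner Cn (column k P) z = cnj ((P *v z) $ k)"
    by (simp add: Cn_def column_def matrix_vector_mult_def sa)
  have e2: "hinner Cn x ?w = hinner Cn x z - cnj t * x $ k" for x
  proof -
    have "hinner Cn x ?w = hinner Cn x z - (\<Sum>i\<in>UNIV. if i = k then cnj t * x $ i else 0)"
      unfolding Cn_def sum_subtractf[symmetric] hilb.simps
      by (rule sum.cong) (auto simp: axis_def algebra_simps)
    then show ?thesis
      by simp
  qed
  have e3: "hinner Cn (P *v z - t *s column k P) y
      = hinner Cn (P *v z) y - t * hinner Cn (column k P) y" for y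
    by (simp add: Cn_def algebra_simps sum_subtractf sum_distrib_left)
  have "hinner Cn (P *v ?w) ?w
      = hinner Cn (P *v z) z - cnj t * (P *v z) $ k - cnj (cnj t * (P *v z) $ k)
        + (t * cnj t) * P $ k $ k"
    unfolding Pw e2 e3 e1 by (simp add: column_def algebra_simps)
  then have "Re (hinner Cn (P *v ?w) ?w) = Re (hinner Cn (P *v z) z)
      - 2 * Re (cnj t * (P *v z) $ k) + (cmod t)\<^sup>2 * Re (P $ k $ k)"
    by (simp add: complex_norm_square[symmetric] del: of_real_power)
  moreover have "0 \<le> Re (hinner Cn (P *v ?w) ?w)"
    using assms by (simp only: psd_def)
  ultimately show ?thesis
    by simp
qed

text \<open>Otherwise take i with \<open>P $ i $ k\<close> nonzero: the form at e_i - t e_k has no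
  positive quadratic term in t, so its linear term can drive it below zero.\<close>

lemma psd_diagonal_pos:
  assumes "psd P" "column k P \<noteq> 0"
  shows "0 < Re (P $ k $ k)"
proof (rule ccontr)
  assume neg: "\<not> 0 < Re (P $ k $ k)"
  obtain i where i: "P $ i $ k \<noteq> 0"
    using assms(2) by (auto simp: column_def vec_eq_iff)
  have sa: "cnj (P $ i $ j) = P $ j $ i" for i j
    using assms by (simp add: psd_def self_adjoint_def conj_transpose_def vec_eq_iff)
  define z :: "complex ^ 'a" where "z = axis i 1"
  define u where "u = (P *v z) $ k"
  have u: "u \<noteq> 0"
    using i sa[of k i, symmetric] by (auto simp: u_def z_def matrix_vector_mult_axis column_def)
  define r where "r = Re (hinner Cn (P *v z) z)"
  \<comment> \<open>With t = s u the linear term is exactly r + 1, so the form drops to at most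
    -1.\<close>
  define s where "s = (r + 1) / (2 * (cmod u)\<^sup>2)"
  have "0 \<le> r - 2 * Re (cnj (of_real s * u) * u) + (cmod (of_real s * u))\<^sup>2 * Re (P $ k $ k)"
    unfolding r_def u_def by (rule psd_column_perturb[OF assms(1)])
  moreover have "Re (cnj (of_real s * u) * u) = s * (cmod u)\<^sup>2"
    by (simp only: cmod_power2) (simp add: power2_eq_square algebra_simps)
  moreover have "(cmod (of_real s * u))\<^sup>2 * Re (P $ k $ k) \<le> 0"
    using neg by (simp add: mult_nonneg_nonpos)
  moreover have "2 * (s * (cmod u)\<^sup>2) = r + 1"
    using u by (simp add: s_def)
  ultimately show False
    by linarith
qed

text \<open>Elimination as in the Cholesky decomposition: each round splits off one rank-one matrix
  built from a nonzero column, and the number of nonzero columns decreases.\<close>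

lemma psd_sum_outer:
  assumes "psd P"
  shows "\<exists>as. P = (\<Sum>a\<leftarrow>as. outer a)"
  using assms
proof (induction "card {k. column k P \<noteq> 0}" arbitrary: P rule: less_induct)
  case less
  show ?case
  proof (cases "\<exists>k. column k P \<noteq> 0")
    case False
    then have "P = 0"
      by (simp add: column_def vec_eq_iff)
    then have "P = (\<Sum>a\<leftarrow>[]. outer a)"
      by simp
    then show ?thesis ..
  next
    case True
    then obtain k where k: "column k P \<noteq> 0" ..
    define q where "q = Re (P $ k $ k)"
    have q: "0 < q"
      unfolding q_def using less.prems k by (rule psd_diagonal_pos)
    have sa: "cnj (P $ i $ j) = P $ j $ i" for i j
      using less.prems by (simp add: psd_def self_adjoint_def conj_transpose_def vec_eq_iff)
    have Pkk: "P $ k $ k = of_real q"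
      using sa[of k k] by (simp add: q_def complex_eq_iff)
    \<comment> \<open>The factor 1 / sqrt q makes \<open>outer a\<close> agree with \<open>P\<close>
      in column k, since the entry of \<open>P\<close> at (k, k) is q.\<close>
    define a where "a = of_real (1 / sqrt q) *s column k P"
    have "complex_of_real (sqrt q) * complex_of_real (sqrt q) = of_real q"
      using q by (simp flip: of_real_mult)
    then have outer_a: "outer a $ i $ j = P $ i $ k * P $ k $ j / of_real q" for i j
      by (simp add: outer_def a_def column_def sa)
    txt \<open>\<open>Q\<close> is the Schur complement: it stays positive, loses column \<open>k\<close> and gains no new
      nonzero column.\<close>
    define Q where "Q = P - outer a"
    have "psd Q"
      unfolding psd_def
    proof (intro conjI allI)
      show "self_adjoint Q"
        by (simp add: self_adjoint_def conj_transpose_def vec_eq_iff Q_def outer_a sa mult.commute)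
      fix z
      define u where "u = (P *v z) $ k"
      \<comment> \<open>The choice t = u / q minimizes the perturbed form over t; the minimum is the
        form of \<open>Q\<close> at z.\<close>
      have "0 \<le> Re (hinner Cn (P *v z) z) - 2 * Re (cnj (u / of_real q) * u)
          + (cmod (u / of_real q))\<^sup>2 * Re (P $ k $ k)"
        unfolding u_def by (rule psd_column_perturb[OF less.prems])
      moreover have "Re (cnj (u / of_real q) * u) = (cmod u)\<^sup>2 / q"
        by (simp add: cmod_power2 flip: power2_eq_square add_divide_distrib)
      moreover have "(cmod (u / of_real q))\<^sup>2 * Re (P $ k $ k) = (cmod u)\<^sup>2 / q"
        using q by (simp add: q_def[symmetric] norm_divide power2_eq_square)
      moreover have "Re (hinner Cn (outer a *v z) z) = (cmod u)\<^sup>2 / q"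
      proof -
        have za: "hinner Cn z a = of_real (1 / sqrt q) * u"
          by (simp add: Cn_def a_def u_def matrix_vector_mult_def column_def sa sum_divide_distrib
              mult.commute)
        then show ?thesis
          unfolding hinner_outer using q by (simp add: norm_mult norm_divide power_divide)
      qed
      moreover have "Re (hinner Cn (Q *v z) z)
          = Re (hinner Cn (P *v z) z) - Re (hinner Cn (outer a *v z) z)"
        by (simp add: Q_def matrix_vector_mult_diff_rdistrib Cn_def sum_subtractf algebra_simps)
      ultimately show "0 \<le> Re (hinner Cn (Q *v z) z)"
        by linarith
    qed
    have "{j. column j Q \<noteq> 0} \<subset> {j. column j P \<noteq> 0}"
    proof (rule psubsetI)
      have "column j Q = 0" if "column j P = 0" for j
        using that by (simp add: column_def vec_eq_iff Q_def outer_a)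
      then show "{j. column j Q \<noteq> 0} \<subseteq> {j. column j P \<noteq> 0}"
        by auto
      have "column k Q = 0"
        using q by (simp add: column_def vec_eq_iff Q_def outer_a Pkk)
      then show "{j. column j Q \<noteq> 0} \<noteq> {j. column j P \<noteq> 0}"
        using k by auto
    qed
    then have "card {j. column j Q \<noteq> 0} < card {j. column j P \<noteq> 0}"
      by (intro psubset_card_mono) auto
    then obtain as where "Q = (\<Sum>a\<leftarrow>as. outer a)"
      using less.hyps \<open>psd Q\<close> by blast
    then have "P = (\<Sum>a\<leftarrow>a # as. outer a)"
      by (simp add: Q_def algebra_simps)
    then show ?thesis ..
  qed
qed

text \<open>Each rank-one piece is tagged with the index of the matrix it comes from. As the list
  does not depend on f, the same pieces serve for the sum of the family and for every weighted sum
  of it.\<close>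

lemma psd_family_sum_outer:
  assumes "finite I" "\<And>i. i \<in> I \<Longrightarrow> psd (P i)"
  shows "\<exists>ps. fst ` set ps \<subseteq> I \<and>
    (\<forall>f. (\<Sum>i\<in>I. (f i :: real) *\<^sub>R P i) = (\<Sum>(i, a)\<leftarrow>ps. f i *\<^sub>R outer a))"
  using assms
proof (induction I rule: finite_induct)
  case empty
  show ?case
    by (rule exI[of _ "[]"]) simp
next
  case (insert j I)
  then obtain ps where ps: "fst ` set ps \<subseteq> I"
    "\<And>f. (\<Sum>i\<in>I. (f i :: real) *\<^sub>R P i) = (\<Sum>(i, a)\<leftarrow>ps. f i *\<^sub>R outer a)"
    by auto
  obtain as where as: "P j = (\<Sum>a\<leftarrow>as. outer a)"
    using psd_sum_outer insert.prems by blast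
  have "r *\<^sub>R (\<Sum>a\<leftarrow>as. outer a) = (\<Sum>a\<leftarrow>as. r *\<^sub>R outer a)" for r :: real
    by (induction as) (auto simp: scaleR_add_right)
  then show ?case
    using insert.hyps ps
    by (intro exI[of _ "map (Pair j) as @ ps"]) (auto simp: as comp_def)
qed

section \<open>Adjoints, and diagonal operators on a finite-dimensional Hilbert space\<close>

text \<open>The definite description in \<open>op_adj\<close> needs uniqueness: on the carrier, the
  difference d of two candidate values is orthogonal to itself, hence zero; off the carrier both
  candidates are \<open>undefined\<close>.\<close>

lemma adjoint_eqI:
  assumes "hilbert_space G" "S \<in> bounded_ops H G"
    and T: "\<And>x. x \<in> hcar G \<Longrightarrow> T x \<in> hcar H"
    and adj: "\<And>x y. x \<in> hcar G \<Longrightarrow> y \<in> hcar H \<Longrightarrow> hinner H (T x) y = hinner G x (S y)"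
  shows "op_adj G H T = S"
  unfolding op_adj_def
proof (rule the_equality)
  interpret hilbert_space G
    by fact
  fix R
  assume R: "R \<in> bounded_ops H G \<and>
    (\<forall>x\<in>hcar G. \<forall>y\<in>hcar H. hinner H (T x) y = hinner G x (R y))"
  show "R = S"
  proof
    fix y
    show "R y = S y"
    proof (cases "y \<in> hcar H")
      case False
      then show ?thesis
        using R assms(2) by (simp add: bounded_ops_def PiE_def extensional_def)
    next
      case True
      then have mem: "R y \<in> hcar G" "S y \<in> hcar G"
        using R assms(2) by (auto simp: bounded_ops_def)
      define d where "d = hdiff G (R y) (S y)"
      have d: "d \<in> hcar G"
        using mem by (simp add: d_def hdiff_def add_closed scale_closed)
      have "hinner G d (R y) = hinner G d (S y)"
        using R adj d True by auto
      then have "hinner G (R y) d = hinner G (S y) d"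
        using mem d by (metis inner_commute)
      then have "hinner G d d = 0"
        using mem d by (subst (1) d_def) (simp add: hdiff_def inner_add inner_scale scale_closed)
      then have "d = hzero G"
        using inner_pos d by force
      then have "R y = hadd G (S y) d"
        using mem diff_self[OF mem(2)] unfolding d_def hdiff_def
        by (metis add_assoc add_commute add_zero scale_closed)
      then show ?thesis
        using \<open>d = hzero G\<close> mem by (simp add: add_zero)
    qed
  qed
qed (use assms in auto)

text \<open>A copy of the M-dimensional complex Euclidean space inside the carrier type that
  \<open>Wmin\<close> prescribes. The dimension is a number and not a type, because it will be the
  length of a list of rank-one pieces.\<close>

definition fin_l2 :: "nat \<Rightarrow> (nat \<Rightarrow> complex) hilb" where
  "fin_l2 M = \<lparr>hcar = {x. \<forall>m\<ge>M. x m = 0}, hadd = (\<lambda>x y m. x m + y m), hzero = (\<lambda>m. 0),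
     hscale = (\<lambda>a x m. a * x m), hinner = (\<lambda>x y. \<Sum>m<M. x m * cnj (y m))\<rparr>"

lemma hnorm_fin_l2: "hnorm (fin_l2 M) x = L2_set (\<lambda>m. cmod (x m)) {..<M}"
  by (simp add: hnorm_def fin_l2_def L2_set_def complex_norm_square[symmetric] del: of_real_power)

lemma hdiff_fin_l2: "hdiff (fin_l2 M) x y = (\<lambda>m. x m - y m)"
  by (simp add: hdiff_def fin_l2_def)

lemma cmod_le_hnorm_fin_l2: "m < M \<Longrightarrow> cmod (x m) \<le> hnorm (fin_l2 M) x"
  unfolding hnorm_fin_l2 by (rule member_le_L2_set) auto

text \<open>Completeness is checked coordinatewise: each coordinate is dominated by the norm, and
  the norm by the sum of the moduli of the coordinates.\<close>

lemma hilbert_space_fin_l2: "hilbert_space (fin_l2 M)"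
proof
  fix x
  assume x: "x \<in> hcar (fin_l2 M)" "x \<noteq> hzero (fin_l2 M)"
  then obtain m where "x m \<noteq> 0"
    by (auto simp: fin_l2_def)
  moreover from this x have "m < M"
    by (force simp: fin_l2_def not_less)
  ultimately have "0 < hnorm (fin_l2 M) x"
    using cmod_le_hnorm_fin_l2[of m M x] by (smt (verit) zero_less_norm_iff)
  then show "0 < Re (hinner (fin_l2 M) x x)"
    by (simp add: hnorm_def)
next
  fix s :: "nat \<Rightarrow> nat \<Rightarrow> complex"
  assume s: "range s \<subseteq> hcar (fin_l2 M)"
    and cau: "\<forall>e>0. \<exists>n::nat. \<forall>m\<ge>n. \<forall>k\<ge>n. hnorm (fin_l2 M) (hdiff (fin_l2 M) (s m) (s k)) < e"
  have "convergent (\<lambda>k. s k i)" if "i < M" for i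
  proof -
    have "Cauchy (\<lambda>k. s k i)"
      unfolding Cauchy_def dist_norm
    proof (intro allI impI)
      fix e :: real
      assume "0 < e"
      then obtain n where n: "\<forall>m\<ge>n. \<forall>k\<ge>n. hnorm (fin_l2 M) (hdiff (fin_l2 M) (s m) (s k)) < e"
        using cau by blast
      have "cmod (s m i - s k i) < e" if "m \<ge> n" "k \<ge> n" for m k
        using n that cmod_le_hnorm_fin_l2[OF \<open>i < M\<close>, of "hdiff (fin_l2 M) (s m) (s k)"]
        by (force simp: hdiff_fin_l2)
      then show "\<exists>n. \<forall>m\<ge>n. \<forall>k\<ge>n. cmod (s m i - s k i) < e"
        by blast
    qed
    then show ?thesis
      by (simp add: Cauchy_convergent_iff)
  qed
  then have lim: "(\<lambda>k. s k i) \<longlonglongrightarrow> lim (\<lambda>k. s k i)" if "i < M" for i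
    using that by (simp add: convergent_LIMSEQ_iff)
  \<comment> \<open>The value 0 from M on puts the limit into the carrier.\<close>
  define l where "l = (\<lambda>i. if i < M then lim (\<lambda>k. s k i) else 0)"
  have "(\<lambda>k. \<Sum>i<M. cmod (s k i - l i)) \<longlonglongrightarrow> (\<Sum>i<M. 0)"
    by (intro tendsto_sum tendsto_norm_zero LIM_zero) (use lim in \<open>auto simp: l_def\<close>)
  then have "(\<lambda>k. \<Sum>i<M. cmod (s k i - l i)) \<longlonglongrightarrow> 0"
    by simp
  then have "(\<lambda>k. hnorm (fin_l2 M) (hdiff (fin_l2 M) (s k) l)) \<longlonglongrightarrow> 0"
    by (rule tendsto_sandwich[OF _ _ tendsto_const, rotated 2])
       (auto simp: hnorm_fin_l2 hdiff_fin_l2 L2_set_nonneg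
          intro!: always_eventually L2_set_le_sum)
  moreover have "l \<in> hcar (fin_l2 M)"
    by (simp add: fin_l2_def l_def)
  ultimately show "\<exists>l\<in>hcar (fin_l2 M). (\<lambda>k. hnorm (fin_l2 M) (hdiff (fin_l2 M) (s k) l)) \<longlonglongrightarrow> 0"
    by blast
qed (auto simp: hdiff_def fin_l2_def algebra_simps sum.distrib sum_distrib_left)

definition diag_op :: "nat \<Rightarrow> (nat \<Rightarrow> complex) \<Rightarrow> (nat \<Rightarrow> complex) \<Rightarrow> nat \<Rightarrow> complex" where
  "diag_op M f = (\<lambda>x\<in>hcar (fin_l2 M). \<lambda>m. f m * x m)"

lemma diag_op_bounded: "diag_op M f \<in> bounded_ops (fin_l2 M) (fin_l2 M)"
proof -
  \<comment> \<open>The sum of the moduli is a crude bound; unlike their maximum it also makes sense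
    for M = 0.\<close>
  have "hnorm (fin_l2 M) (diag_op M f x) \<le> (\<Sum>m<M. cmod (f m)) * hnorm (fin_l2 M) x"
    if "x \<in> hcar (fin_l2 M)" for x
  proof -
    have "hnorm (fin_l2 M) (diag_op M f x) \<le> (\<Sum>m<M. cmod (f m * x m))"
      using that by (simp add: hnorm_fin_l2 diag_op_def L2_set_le_sum)
    also have "\<dots> \<le> (\<Sum>m<M. cmod (f m) * hnorm (fin_l2 M) x)"
      by (intro sum_mono) (simp add: norm_mult mult_left_mono cmod_le_hnorm_fin_l2)
    finally show ?thesis
      by (simp add: sum_distrib_right)
  qed
  then show ?thesis
    unfolding bounded_ops_def
    by (auto simp: diag_op_def fin_l2_def algebra_simps)
qed

lemma diag_op_one: "diag_op M (\<lambda>_. 1) = op_id (fin_l2 M)"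
  by (simp add: diag_op_def op_id_def)

lemma diag_op_add: "op_add (fin_l2 M) (diag_op M f) (diag_op M g) = diag_op M (\<lambda>m. f m + g m)"
  by (rule ext) (auto simp: diag_op_def op_add_def fin_l2_def algebra_simps)

lemma diag_op_scale: "op_scale (fin_l2 M) a (diag_op M f) = diag_op M (\<lambda>m. a * f m)"
  by (rule ext) (auto simp: diag_op_def op_scale_def fin_l2_def algebra_simps)

lemma diag_op_mult: "op_mult (fin_l2 M) (diag_op M f) (diag_op M g) = diag_op M (\<lambda>m. f m * g m)"
  by (rule ext) (auto simp: diag_op_def op_mult_def compose_def fin_l2_def algebra_simps)

lemma diag_op_adj: "op_adj (fin_l2 M) (fin_l2 M) (diag_op M f) = diag_op M (\<lambda>m. cnj (f m))"
  by (rule adjoint_eqI[OF hilbert_space_fin_l2 diag_op_bounded])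
     (auto simp: diag_op_def fin_l2_def mult_ac)

lemma normal_diag_op: "normal_op (fin_l2 M) (diag_op M f)"
  by (simp add: normal_op_def diag_op_bounded diag_op_adj diag_op_mult mult.commute)

lemma diag_op_cong:
  assumes "\<And>m. m < M \<Longrightarrow> f m = g m"
  shows "diag_op M f = diag_op M g"
proof -
  have "(\<lambda>m. f m * x m) = (\<lambda>m. g m * x m)" if "x \<in> hcar (fin_l2 M)" for x
  proof
    fix m
    show "f m * x m = g m * x m"
      using assms[of m] that by (cases "m < M") (auto simp: fin_l2_def)
  qed
  then show ?thesis
    unfolding diag_op_def by (rule restrict_ext)
qed

section \<open>Joint spectrum of diagonal operators\<close>

lemma cstar_gen_closed:
  "G \<subseteq> cstar_gen H G"
  "op_id H \<in> cstar_gen H G"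
  "S \<in> cstar_gen H G \<Longrightarrow> T \<in> cstar_gen H G \<Longrightarrow> op_add H S T \<in> cstar_gen H G"
  "S \<in> cstar_gen H G \<Longrightarrow> T \<in> cstar_gen H G \<Longrightarrow> op_mult H S T \<in> cstar_gen H G"
  "T \<in> cstar_gen H G \<Longrightarrow> op_scale H a T \<in> cstar_gen H G"
  by (auto simp: cstar_gen_def unital_cstar_subalgebra_def)

text \<open>A character respects polynomial relations between the operators. A point outside the
  finite set of the \<open>\<mu> m\<close> violates one: choose for each m a coordinate
  \<open>J m\<close> in which it differs from \<open>\<mu> m\<close>, and multiply the corresponding
  linear factors.\<close>

lemma joint_spectrum_diag_op:
  fixes \<mu> :: "nat \<Rightarrow> complex ^ 'd"
  shows "joint_spectrum (fin_l2 M) (\<lambda>j. diag_op M (\<lambda>m. \<mu> m $ j)) \<subseteq> \<mu> ` {..<M}"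
proof
  let ?L = "fin_l2 M" and ?N = "\<lambda>j. diag_op M (\<lambda>m. \<mu> m $ j)"
  let ?A = "cstar_gen ?L (range ?N)"
  fix x
  assume "x \<in> joint_spectrum ?L ?N"
  then obtain \<phi> where char: "character_on ?L ?A \<phi>" and x: "x = (\<chi> j. \<phi> (?N j))"
    by (auto simp: joint_spectrum_def)
  show "x \<in> \<mu> ` {..<M}"
  proof (rule ccontr)
    assume "x \<notin> \<mu> ` {..<M}"
    then have "\<forall>m\<in>{..<M}. \<exists>j. x $ j \<noteq> \<mu> m $ j"
      by (metis image_eqI vec_eq_iff)
    then obtain J where J: "\<And>m. m < M \<Longrightarrow> x $ J m \<noteq> \<mu> m $ J m"
      by (metis lessThan_iff)
    have N: "?N j \<in> ?A" "\<phi> (?N j) = x $ j" for j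
      using cstar_gen_closed(1)[of "range ?N" ?L] by (auto simp: x)
    have id: "diag_op M (\<lambda>_. 1) \<in> ?A" "\<phi> (diag_op M (\<lambda>_. 1)) = 1"
      using char by (auto simp: diag_op_one character_on_def cstar_gen_closed)
    have const: "diag_op M (\<lambda>_. b) \<in> ?A" "\<phi> (diag_op M (\<lambda>_. b)) = b" for b
    proof -
      have "diag_op M (\<lambda>_. b) = op_scale ?L b (diag_op M (\<lambda>_. 1))"
        by (simp add: diag_op_scale)
      then show "diag_op M (\<lambda>_. b) \<in> ?A" "\<phi> (diag_op M (\<lambda>_. b)) = b"
        using char id by (auto simp: character_on_def intro: cstar_gen_closed)
    qed
    have lin: "diag_op M (\<lambda>m. \<mu> m $ j - b) \<in> ?A \<and> \<phi> (diag_op M (\<lambda>m. \<mu> m $ j - b)) = x $ j - b"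
      for j b
    proof -
      have "diag_op M (\<lambda>m. \<mu> m $ j - b) = op_add ?L (?N j) (diag_op M (\<lambda>_. - b))"
        by (simp add: diag_op_add)
      then show ?thesis
        using char N const by (auto simp: character_on_def intro: cstar_gen_closed)
    qed
    txt \<open>The product of the \<open>N\<^bsub>J k\<^esub> - \<mu> k $ J k\<close> over \<open>k < M\<close> vanishes, whereas its image under \<open>\<phi>\<close> would not.\<close>
    have prod: "diag_op M (\<lambda>m. \<Prod>k<n. \<mu> m $ J k - \<mu> k $ J k) \<in> ?A \<and>
        \<phi> (diag_op M (\<lambda>m. \<Prod>k<n. \<mu> m $ J k - \<mu> k $ J k)) = (\<Prod>k<n. x $ J k - \<mu> k $ J k)" for n
    proof (induction n)
      case 0
      then show ?case
        using id by simp
    next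
      case (Suc n)
      have "diag_op M (\<lambda>m. \<Prod>k<Suc n. \<mu> m $ J k - \<mu> k $ J k)
          = op_mult ?L (diag_op M (\<lambda>m. \<Prod>k<n. \<mu> m $ J k - \<mu> k $ J k))
              (diag_op M (\<lambda>m. \<mu> m $ J n - \<mu> n $ J n))"
        by (simp add: diag_op_mult)
      then show ?case
        using char Suc lin[of "J n" "\<mu> n $ J n"]
        by (auto simp: character_on_def intro: cstar_gen_closed)
    qed
    \<comment> \<open>At entry m the factor with k = m is zero. For M = 0 the empty products then
      yield 1 = 0, so there is no character at all.\<close>
    have "diag_op M (\<lambda>m. \<Prod>k<M. \<mu> m $ J k - \<mu> k $ J k) = diag_op M (\<lambda>_. 0)"
      by (rule diag_op_cong) (auto simp: prod_zero_iff)
    then have "(\<Prod>k<M. x $ J k - \<mu> k $ J k) = 0"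
      using prod[of M] const(2)[of 0] by simp
    then show False
      using J by auto
  qed
qed

section \<open>Dilation of a positive partition of the identity\<close>

text \<open>When the outer products add up to the identity, this becomes Parseval's identity, which
  makes the dilation map isometric.\<close>

lemma hinner_sum_outer:
  fixes a :: "nat \<Rightarrow> complex ^ 'n"
  shows "hinner Cn ((\<Sum>m<M. outer (a m)) *v z) z = of_real (\<Sum>m<M. (cmod (hinner Cn z (a m)))\<^sup>2)"
proof (induction M)
  case 0
  then show ?case
    by (simp add: Cn_def)
next
  case (Suc M)
  have "hinner Cn (x + y) z = hinner Cn x z + hinner Cn y z" for x y :: "complex ^ 'n"
    by (simp add: Cn_def sum.distrib algebra_simps)
  then show ?case
    using Suc by (simp add: matrix_vector_mult_add_rdistrib hinner_outer)
qed

lemma sum_outer_mult_vec: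
  fixes a :: "nat \<Rightarrow> complex ^ 'n" and f :: "nat \<Rightarrow> real"
  shows "(\<Sum>m<M. f m *\<^sub>R outer (a m)) *v z
    = (\<Sum>m<M. (of_real (f m) * hinner Cn z (a m)) *s a m)"
proof (induction M)
  case (Suc M)
  then show ?case
    by (simp add: matrix_vector_mult_add_rdistrib outer_mult_vec scaleR_matrix_vector_mult vector_smult_assoc)
qed simp

text \<open>A Naimark dilation: the a_m form a Parseval frame, and compressing a diagonal operator
  by its analysis map yields the outer products weighted with the diagonal entries.\<close>

lemma Wmin_sum_outer:
  fixes a :: "nat \<Rightarrow> complex ^ 'n" and \<mu> :: "nat \<Rightarrow> real ^ 'd"
  assumes one: "(\<Sum>m<M. outer (a m)) = mat 1"
    and E: "\<And>m. m < M \<Longrightarrow> \<mu> m \<in> E"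
    and X: "\<And>j. X $ j = (\<Sum>m<M. (\<mu> m $ j) *\<^sub>R outer (a m))"
  shows "X \<in> Wmin E"
proof -
  let ?L = "fin_l2 M"
  \<comment> \<open>The entries are written as coordinates of a vector to fit the shape of
    \<open>joint_spectrum_diag_op\<close>.\<close>
  let ?N = "\<lambda>j. diag_op M (\<lambda>m. (\<chi> j. complex_of_real (\<mu> m $ j)) $ j)"
  define V where "V z m = (if m < M then hinner Cn z (a m) else 0)" for z m
  \<comment> \<open>The synthesis map of the frame, which is the adjoint of the analysis map
    \<open>V\<close>.\<close>
  define W where "W = (\<lambda>y\<in>hcar ?L. \<Sum>m<M. y m *s a m)"
  have norm_V: "hnorm ?L (V z) = hnorm Cn z" for z
  proof -
    have "(\<Sum>m<M. (cmod (hinner Cn z (a m)))\<^sup>2) = Re (hinner Cn z z)"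
      using hinner_sum_outer[of a M z] one by simp
    then show ?thesis
      unfolding hnorm_fin_l2 L2_set_def by (simp add: V_def hnorm_def)
  qed
  have "V \<in> bounded_ops Cn ?L"
    unfolding bounded_ops_def
  proof (intro CollectI conjI)
    show "\<exists>B. \<forall>x\<in>hcar Cn. hnorm ?L (V x) \<le> B * hnorm Cn x"
      by (rule exI[of _ 1]) (simp add: norm_V)
  qed (auto simp: V_def Cn_def fin_l2_def fun_eq_iff algebra_simps sum.distrib sum_distrib_left)
  then have iso: "isometry_op Cn ?L V"
    by (simp add: isometry_op_def norm_V)
  have "W \<in> bounded_ops ?L Cn"
    unfolding bounded_ops_def
  proof (intro CollectI conjI)
    show "\<exists>B. \<forall>x\<in>hcar ?L. hnorm Cn (W x) \<le> B * hnorm ?L x"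
    proof (intro exI ballI)
      fix y
      assume y: "y \<in> hcar ?L"
      have ns: "norm (b *s u) = cmod b * norm u" for b and u :: "complex ^ 'n"
        by (simp add: norm_vec_def norm_mult L2_set_right_distrib)
      have "hnorm Cn (W y) \<le> (\<Sum>m<M. cmod (y m) * norm (a m))"
        using y by (simp add: hnorm_Cn W_def norm_sum[THEN order_trans] ns)
      also have "\<dots> \<le> (\<Sum>m<M. hnorm ?L y * norm (a m))"
        by (intro sum_mono mult_right_mono) (auto simp: cmod_le_hnorm_fin_l2)
      finally show "hnorm Cn (W y) \<le> (\<Sum>m<M. norm (a m)) * hnorm ?L y"
        by (simp add: sum_distrib_left mult.commute)
    qed
  qed (auto simp: W_def Cn_def fin_l2_def vec_eq_iff algebra_simps sum.distrib sum_distrib_left)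
  then have adj: "op_adj Cn ?L V = W"
  proof (rule adjoint_eqI[OF hilbert_space_Cn])
    fix x :: "complex ^ 'n" and y
    assume y: "y \<in> hcar ?L"
    have "hinner ?L (V x) y = (\<Sum>m<M. \<Sum>i\<in>UNIV. x $ i * cnj (a m $ i) * cnj (y m))"
      by (simp add: fin_l2_def V_def Cn_def sum_distrib_right)
    also have "\<dots> = (\<Sum>i\<in>UNIV. \<Sum>m<M. x $ i * cnj (a m $ i) * cnj (y m))"
      by (rule sum.swap)
    also have "\<dots> = hinner Cn x (W y)"
      using y by (simp add: Cn_def W_def sum_distrib_left mult_ac)
    finally show "hinner ?L (V x) y = hinner Cn x (W y)" .
  qed (simp add: V_def fin_l2_def)
  have XW: "X $ j *v z = W (?N j (V z))" for j z
  proof -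
    \<comment> \<open>Both \<open>diag_op\<close> and \<open>W\<close> are restricted to the
      carrier, so membership has to be known before they unfold.\<close>
    have "V z \<in> hcar ?L" "?N j (V z) \<in> hcar ?L"
      by (auto simp: V_def fin_l2_def diag_op_def)
    then have "W (?N j (V z)) = (\<Sum>m<M. (of_real (\<mu> m $ j) * hinner Cn z (a m)) *s a m)"
      by (simp add: W_def diag_op_def V_def)
    then show ?thesis
      by (simp only: X sum_outer_mult_vec)
  qed
  have "joint_spectrum ?L ?N \<subseteq> (\<lambda>m. \<chi> j. complex_of_real (\<mu> m $ j)) ` {..<M}"
    by (rule joint_spectrum_diag_op)
  also have "\<dots> \<subseteq> (\<lambda>x. \<chi> j. complex_of_real (x $ j)) ` E"
    using E by blast
  finally have "normal_dilation ?L E X"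
    unfolding normal_dilation_def
    by (intro exI[of _ ?N] exI[of _ V] conjI allI normal_diag_op iso)
       (simp_all add: diag_op_mult adj XW mult.commute)
  moreover have "self_adjoint (X $ j)" for j
    by (simp add: X self_adjoint_def conj_transpose_def vec_eq_iff outer_def mult.commute)
  ultimately show ?thesis
    using hilbert_space_fin_l2 by (auto simp: Wmin_def)
qed

text \<open>Every rank-one piece of \<open>P i\<close> inherits the point \<open>\<mu> i\<close>;
  positions in the list of pieces number the diagonal entries.\<close>

lemma Wmin_psd_partition:
  fixes P :: "'i \<Rightarrow> complex ^ 'n ^ 'n" and \<mu> :: "'i \<Rightarrow> real ^ 'd"
  assumes "finite I" "\<And>i. i \<in> I \<Longrightarrow> psd (P i)" "(\<Sum>i\<in>I. P i) = mat 1"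
    and E: "\<And>i. i \<in> I \<Longrightarrow> \<mu> i \<in> E"
    and X: "\<And>j. X $ j = (\<Sum>i\<in>I. (\<mu> i $ j) *\<^sub>R P i)"
  shows "X \<in> Wmin E"
proof -
  obtain ps where ps: "fst ` set ps \<subseteq> I"
    "\<And>f. (\<Sum>i\<in>I. (f i :: real) *\<^sub>R P i) = (\<Sum>(i, a)\<leftarrow>ps. f i *\<^sub>R outer a)"
    using psd_family_sum_outer[of I P] assms(1,2) by blast
  have nth: "(\<Sum>i\<in>I. (f i :: real) *\<^sub>R P i)
      = (\<Sum>m<length ps. f (fst (ps ! m)) *\<^sub>R outer (snd (ps ! m)))" for f
    by (simp add: ps(2) sum_list_sum_nth case_prod_beta atLeast0LessThan)
  show ?thesis
  proof (rule Wmin_sum_outer)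
    show "(\<Sum>m<length ps. outer (snd (ps ! m))) = mat 1"
      using nth[of "\<lambda>_. 1"] assms(3) by simp
    show "\<mu> (fst (ps ! m)) \<in> E" if "m < length ps" for m
      using E ps(1) that by (auto simp: image_subset_iff)
    show "X $ j = (\<Sum>m<length ps. (\<mu> (fst (ps ! m)) $ j) *\<^sub>R outer (snd (ps ! m)))" for j
      by (simp add: X nth)
  qed
qed

section \<open>The positive semidefinite cone and the frame operator\<close>

lemma psd_one: "psd (mat 1)"
proof -
  have "Re (hinner Cn z z) = (norm z)\<^sup>2" for z :: "complex ^ 'a"
    by (metis hnorm_Cn hnorm_def norm_ge_zero real_sqrt_ge_0_iff real_sqrt_pow2)
  moreover have "self_adjoint (mat 1 :: complex ^ 'a ^ 'a)"
    by (simp add: self_adjoint_def conj_transpose_def vec_eq_iff mat_def)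
  ultimately show ?thesis
    by (simp add: psd_def)
qed

lemma psd_add:
  assumes "psd A" "psd B"
  shows "psd (A + B)"
proof -
  have "hinner Cn ((A + B) *v z) z = hinner Cn (A *v z) z + hinner Cn (B *v z) z" for z
    by (simp add: matrix_vector_mult_add_rdistrib Cn_def sum.distrib algebra_simps)
  then show ?thesis
    using assms by (auto simp: psd_def self_adjoint_def conj_transpose_def vec_eq_iff)
qed

lemma psd_scaleR:
  assumes "0 \<le> r" "psd A"
  shows "psd (r *\<^sub>R A)"
proof -
  have "hinner Cn ((r *\<^sub>R A) *v z) z = of_real r * hinner Cn (A *v z) z" for z
    unfolding scaleR_matrix_vector_mult by (simp add: Cn_def sum_distrib_left mult_ac)
  then show ?thesis
    using assms by (auto simp: psd_def self_adjoint_def conj_transpose_def vec_eq_iff)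
qed

text \<open>Polarization of the frame identity at e_j + e_k: the frame operator is \<sigma> times
  the identity.\<close>

lemma tight_frame_gram:
  fixes v :: "nat \<Rightarrow> real ^ 'd"
  assumes "tight_frame N v \<sigma>"
  shows "(\<Sum>i=1..N. v i $ j * v i $ k) = (if j = k then \<sigma> else 0)"
proof -
  let ?f = "\<lambda>x. \<Sum>i=1..N. (v i \<bullet> x)\<^sup>2"
  have f: "?f x = \<sigma> * (x \<bullet> x)" for x
    using assms by (simp add: tight_frame_def power2_norm_eq_inner)
  let ?e = "\<lambda>j. axis j 1 :: real ^ 'd"
  have "?f (?e j + ?e k) = ?f (?e j) + ?f (?e k) + 2 * (\<Sum>i=1..N. v i $ j * v i $ k)"
    by (simp add: inner_add_right inner_axis power2_sum sum.distrib sum_distrib_left mult_ac)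
  moreover have "?e j \<bullet> ?e k = (if j = k then 1 else 0)"
    by (simp add: inner_axis_axis)
  ultimately show ?thesis
    unfolding f by (auto simp: inner_add_left inner_add_right inner_commute algebra_simps
        inner_axis_axis)
qed

text \<open>The trace of the frame operator, computed in two ways.\<close>

lemma tight_frame_constant:
  fixes v :: "nat \<Rightarrow> real ^ 'd"
  assumes "tight_frame N v \<sigma>"
  shows "(\<Sum>i=1..N. (norm (v i))\<^sup>2) = real CARD('d) * \<sigma>"
proof -
  have "(\<Sum>i=1..N. (norm (v i))\<^sup>2) = (\<Sum>i=1..N. \<Sum>j\<in>UNIV. v i $ j * v i $ j)"
    by (simp add: power2_norm_eq_inner inner_vec_def)
  also have "\<dots> = (\<Sum>j\<in>(UNIV :: 'd set). \<Sum>i=1..N. v i $ j * v i $ j)"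
    by (rule sum.swap)
  finally show ?thesis
    by (simp add: tight_frame_gram[OF assms] del: One_nat_def)
qed

section \<open>The inclusion for tight frames\<close>

theorem theorem10p14:
  fixes N :: nat and v :: "nat \<Rightarrow> real ^ 'd" and c :: "nat \<Rightarrow> real"
    and \<sigma> \<kappa> :: real and K :: "(real ^ 'd) set"
  assumes frame: "tight_frame N v \<sigma>"
    and c_pos: "\<forall>i\<in>{1..N}. 0 < c i"
    and K: "K = convex hull (\<Union>i\<in>{1..N}. {c i *\<^sub>R v i, - (c i *\<^sub>R v i)})"
    and \<kappa>: "\<kappa> = \<sigma> * Min ((\<lambda>i. c i ^ 3) ` {1..N}) / (\<Sum>i=1..N. c i)"
  shows "\<sigma> = 1 / real CARD('d) * (\<Sum>i=1..N. (norm (v i))\<^sup>2) \<and>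
    \<kappa> = (\<Sum>i=1..N. (norm (v i))\<^sup>2) / (\<Sum>i=1..N. c i) *
        (Min ((\<lambda>i. c i ^ 3) ` {1..N}) / real CARD('d)) \<and>
    (\<lambda>X. \<kappa> *\<^sub>R X) ` (Wmax (polar_dual K) :: ((complex ^ 'n ^ 'n) ^ 'd) set) \<subseteq> Wmin K"
proof (intro conjI)
  show "\<sigma> = 1 / real CARD('d) * (\<Sum>i=1..N. (norm (v i))\<^sup>2)"
    by (simp add: tight_frame_constant[OF frame] del: One_nat_def)
  show "\<kappa> = (\<Sum>i=1..N. (norm (v i))\<^sup>2) / (\<Sum>i=1..N. c i) *
        (Min ((\<lambda>i. c i ^ 3) ` {1..N}) / real CARD('d))"
    by (simp add: tight_frame_constant[OF frame] \<kappa> del: One_nat_def)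
  define m where "m = Min ((\<lambda>i. c i ^ 3) ` {1..N})"
  define S where "S = (\<Sum>i=1..N. c i)"
  have \<sigma>: "0 < \<sigma>"
    using frame by (simp add: tight_frame_def)
  \<comment> \<open>For N = 0 a diagonal entry of the frame operator would be an empty sum, although
    it equals \<sigma> > 0; \<open>undefined\<close> stands for an arbitrary coordinate.\<close>
  have ne: "{1..N} \<noteq> {}"
    using tight_frame_gram[OF frame, of undefined undefined] \<sigma> by (cases "N = 0") auto
  have S: "0 < S"
    unfolding S_def using c_pos ne by (intro sum_pos) auto
  have m_le: "m \<le> c i ^ 3" if "i \<in> {1..N}" for i
    unfolding m_def using that by (intro Min_le) auto
  have "m \<in> (\<lambda>i. c i ^ 3) ` {1..N}"
    unfolding m_def using ne by (intro Min_in) auto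
  then have m: "0 < m"
    using c_pos by auto
  show "(\<lambda>X. \<kappa> *\<^sub>R X) ` (Wmax (polar_dual K) :: ((complex ^ 'n ^ 'n) ^ 'd) set) \<subseteq> Wmin K"
  proof (rule image_subsetI)
    fix X :: "(complex ^ 'n ^ 'n) ^ 'd"
    assume X: "X \<in> Wmax (polar_dual K)"
    define T where "T i = (\<Sum>j\<in>UNIV. v i $ j *\<^sub>R X $ j)" for i
    \<comment> \<open>The partition is indexed by pairs (i, b), where b selects one of the two
      opposite points of \<open>K\<close>.\<close>
    define sgn where "sgn b = (if b then 1 else -1 :: real)" for b
    define \<mu> where "\<mu> = (\<lambda>(i, b). (sgn b * c i) *\<^sub>R v i)"
    \<comment> \<open>Adding the two signs leaves only the identity part, and subtracting them only
      \<open>T i\<close>. The divisor \<open>c i\<close> cancels the factor \<open>c i\<close> of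
      \<open>\<mu>\<close>, so all \<open>T i\<close> get the same weight m / S.\<close>
    define P where "P = (\<lambda>(i, b). (1 / (2 * S)) *\<^sub>R (c i *\<^sub>R mat 1 + (sgn b * m / c i) *\<^sub>R T i))"
    have \<mu>K: "\<mu> (i, b) \<in> K" if "i \<in> {1..N}" for i b
      unfolding K using that by (intro hull_inc) (auto simp: \<mu>_def sgn_def)
    show "\<kappa> *\<^sub>R X \<in> Wmin K"
    proof (rule Wmin_psd_partition[where I = "{1..N} \<times> UNIV" and P = P and \<mu> = \<mu>])
      show "finite ({1..N} \<times> (UNIV :: bool set))"
        by simp
      show "\<mu> p \<in> K" if "p \<in> {1..N} \<times> UNIV" for p
        using that \<mu>K by auto
      show "psd (P p)" if p: "p \<in> {1..N} \<times> UNIV" for p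
      proof -
        obtain i b where i: "p = (i, b)" "i \<in> {1..N}"
          using p by auto
        have c: "0 < c i"
          using c_pos i by simp
        \<comment> \<open>The opposite sign is taken because an upper bound on -(sgn b)
          \<open>c i\<close> \<open>T i\<close> is what makes I + (sgn b) \<open>c i\<close>
          \<open>T i\<close> positive.\<close>
        have "loewner_le (\<Sum>j\<in>UNIV. \<mu> (i, \<not> b) $ j *\<^sub>R X $ j) (1 *\<^sub>R mat 1)"
        proof -
          have "\<forall>x\<in>polar_dual K. (\<Sum>j\<in>UNIV. \<mu> (i, \<not> b) $ j * x $ j) \<le> 1"
            using \<mu>K[OF i(2), of "\<not> b"] by (simp add: polar_dual_def mult.commute)
          then show ?thesis
            using X unfolding Wmax_def by blast
        qed
        moreover have "(\<Sum>j\<in>UNIV. \<mu> (i, \<not> b) $ j *\<^sub>R X $ j) = - ((sgn b * c i) *\<^sub>R T i)"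
          by (simp add: \<mu>_def T_def sgn_def scaleR_sum_right sum_negf)
        ultimately have T: "psd (mat 1 + (sgn b * c i) *\<^sub>R T i)"
          by (simp add: loewner_le_def)
        \<comment> \<open>A nonnegative combination of I and the positive matrix just found; the
          coefficient of I is nonnegative because m is at most the cube of \<open>c i\<close>, which
          is why \<kappa> contains cubes.\<close>
        have "P p = (1 / (2 * S)) *\<^sub>R ((c i - m / c i ^ 2) *\<^sub>R mat 1
            + (m / c i ^ 2) *\<^sub>R (mat 1 + (sgn b * c i) *\<^sub>R T i))"
          using c by (simp add: P_def i(1) scaleR_add_right scaleR_diff_left power2_eq_square mult_ac)
        moreover have "0 \<le> c i - m / c i ^ 2"
          using m_le[OF i(2)] c by (simp add: field_simps power2_eq_square power3_eq_cube)
        ultimately show ?thesis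
          using T m S c by (auto intro!: psd_scaleR psd_add psd_one)
      qed
      have pair: "(\<Sum>p\<in>{1..N} \<times> UNIV. g p) = (\<Sum>i=1..N. g (i, True) + g (i, False))"
        for g :: "nat \<times> bool \<Rightarrow> complex ^ 'n ^ 'n"
        by (simp add: sum.cartesian_product' UNIV_bool add.commute)
      have half: "1 / (2 * S) + 1 / (2 * S) = 1 / S"
        by simp
      have "(1 / (2 * S)) *\<^sub>R (A + B) + (1 / (2 * S)) *\<^sub>R (A - B) = (1 / S) *\<^sub>R A"
        for A B :: "complex ^ 'n ^ 'n"
        unfolding half[symmetric] scaleR_add_left scaleR_add_right scaleR_diff_right by simp
      then have "P (i, True) + P (i, False) = (c i / S) *\<^sub>R mat 1" for i
        by (simp add: P_def sgn_def)
      then have "(\<Sum>p\<in>{1..N} \<times> UNIV. P p) = (\<Sum>i=1..N. (c i / S) *\<^sub>R mat 1)"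
        unfolding pair by simp
      also have "\<dots> = mat 1"
        unfolding scaleR_sum_left[symmetric] sum_divide_distrib[symmetric] S_def[symmetric]
        using S by simp
      finally show "(\<Sum>p\<in>{1..N} \<times> UNIV. P p) = mat 1" .
      fix j
      have "(\<Sum>p\<in>{1..N} \<times> UNIV. \<mu> p $ j *\<^sub>R P p) = (\<Sum>i=1..N. (m / S) *\<^sub>R (v i $ j *\<^sub>R T i))"
        unfolding pair
      proof (rule sum.cong)
        fix i
        assume "i \<in> {1..N}"
        then have c: "c i \<noteq> 0"
          using c_pos by force
        have "\<mu> (i, True) $ j *\<^sub>R P (i, True) + \<mu> (i, False) $ j *\<^sub>R P (i, False)
            = (c i * v i $ j) *\<^sub>R (P (i, True) - P (i, False))"
          by (simp add: \<mu>_def sgn_def scaleR_diff_right)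
        also have "P (i, True) - P (i, False) = (m / (S * c i)) *\<^sub>R T i"
        proof -
          have "(1 / (2 * S)) *\<^sub>R (A + B) - (1 / (2 * S)) *\<^sub>R (A - B) = (1 / S) *\<^sub>R B"
            for A B :: "complex ^ 'n ^ 'n"
            unfolding half[symmetric] scaleR_add_left scaleR_add_right scaleR_diff_right by simp
          then show ?thesis
            by (simp add: P_def sgn_def)
        qed
        finally show "\<mu> (i, True) $ j *\<^sub>R P (i, True) + \<mu> (i, False) $ j *\<^sub>R P (i, False)
            = (m / S) *\<^sub>R (v i $ j *\<^sub>R T i)"
          using c by (simp add: mult_ac)
      qed simp
      also have "\<dots> = (m / S) *\<^sub>R (\<Sum>i=1..N. \<Sum>k\<in>UNIV. (v i $ j * v i $ k) *\<^sub>R X $ k)"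
        by (simp add: T_def scaleR_sum_right)
      also have "\<dots> = (m / S) *\<^sub>R (\<Sum>k\<in>UNIV. (\<Sum>i=1..N. v i $ j * v i $ k) *\<^sub>R X $ k)"
        by (subst sum.swap) (simp add: scaleR_sum_left)
      \<comment> \<open>The frame operator leaves only k = j, and \<sigma> times m / S is
        \<kappa>.\<close>
      also have "(\<Sum>k\<in>UNIV. (\<Sum>i=1..N. v i $ j * v i $ k) *\<^sub>R X $ k) = \<sigma> *\<^sub>R X $ j"
        unfolding tight_frame_gram[OF frame]
        by (simp add: if_distrib[of "\<lambda>r. r *\<^sub>R _"] cong: if_cong)
      finally show "(\<kappa> *\<^sub>R X) $ j = (\<Sum>p\<in>{1..N} \<times> UNIV. \<mu> p $ j *\<^sub>R P p)"
        by (simp add: \<kappa> m_def S_def mult_ac)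
    qed
  qed
qed

end
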